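(* Let $X$ be a Polish space and let $c:X\times X\to\mathbb{R}^+=[0,\infty)$ be a symmetric Borel function. Let $\mu$ be a (Borel) probability measure on $X$ satisfying $\mathbf{T}_c(C)$ for some $C>0$. Then for all $\lambda\in(0,1/C)$ and all functions $f:X\to\mathbb{R}$, $$\operatorname{Ent}_\mu(e^f)\le\frac{1}{1-\lambda C}\int(P^\lambda f-f)\,d\mu\int e^f\,d\mu,\qquad P^\lambda f(x)=\sup_{y\in X}\{f(y)-\lambda c(x,y)\}.$$ Assume moreover that $X=\mathbb{R}^k$ and that the cost is of the form $c(x,y)=c(x-y)$, $x,y\in\mathbb{R}^k$, where $c:\mathbb{R}^k\to\mathbb{R}^+$ is a differentiable symmetric function ($c(-x)=c(x)$) with $c(0)=\nabla c(0)=0$. Then for all $K\ge0$, $\eta>0$ with $\eta+K<1/C$ and all differentiable functions $f:\mathbb{R}^k\to\mathbb{R}$ that are $K$-semi-concave for the cost $c$, $$\operatorname{Ent}_\mu(e^f)\le\frac{\eta}{1-C(\eta+K)}\int c^*\left(\frac{\nabla f}{\eta}\right)d\mu\int e^f\,d\mu.$$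
   Context: $\operatorname{Ent}_\mu(g)=\int g\log g\,d\mu-\int g\,d\mu\,\log\int g\,d\mu$. $H(\nu|\mu)=\int\log\frac{d\nu}{d\mu}\,d\nu$ if $\nu\ll\mu$, $+\infty$ otherwise. $\mathcal{T}_c(\nu,\mu)=\inf_\pi\iint c(x,y)\,d\pi(x,y)$, infimum over probability measures $\pi$ on $X\times X$ with marginals $\nu$ and $\mu$. $\mu$ satisfies $\mathbf{T}_c(C)$ if $\mathcal{T}_c(\nu,\mu)\le C\,H(\nu|\mu)$ for all probability measures $\nu$ on $X$. For $c:\mathbb{R}^k\to\mathbb{R}^+$, $c^*(u)=\sup_{h\in\mathbb{R}^k}\{u\cdot h-c(h)\}\in[0,+\infty]$. A function $g:\mathbb{R}^k\to\mathbb{R}$ is $K$-semi-convex for the cost $c$ if for all $\lambda\in[0,1]$ and $x,y\in\mathbb{R}^k$, $g(\lambda x+(1-\lambda)y)\le\lambda g(x)+(1-\lambda)g(y)+\lambda Kc((1-\lambda)(y-x))+(1-\lambda)Kc(\lambda(y-x))$; $f$ is $K$-semi-concave for the cost $c$ if $-f$ is $K$-semi-convex for the cost $c$. Functions are understood to be measurable, and the functional inequalities are understood for functions $f$ for which the integrals make sense. *)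

theory Defs
  imports "HOL-Probability.Probability"
begin

text \<open>
  Entropies and integrals here may be infinite, so the Bochner integral (which is 0 on
  non-integrable functions) is replaced by the difference of the integrals of the positive and
  negative parts; the function \<open>e2ennreal\<close> sends negative arguments to 0. The value is meaningful
  when \<open>has_ext_integral\<close> holds, i.e. the function is measurable and it is not of the form
  \<open>\<infinity> - \<infinity>\<close>.
\<close>

definition ext_integral :: "'a measure \<Rightarrow> ('a \<Rightarrow> ereal) \<Rightarrow> ereal" where
  "ext_integral M u =
     enn2ereal (\<integral>\<^sup>+ x. e2ennreal (u x) \<partial>M) - enn2ereal (\<integral>\<^sup>+ x. e2ennreal (- u x) \<partial>M)"

definition has_ext_integral :: "'a measure \<Rightarrow> ('a \<Rightarrow> ereal) \<Rightarrow> bool" where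
  "has_ext_integral M u \<longleftrightarrow> u \<in> borel_measurable M \<and>
     ((\<integral>\<^sup>+ x. e2ennreal (u x) \<partial>M) < \<infinity> \<or> (\<integral>\<^sup>+ x. e2ennreal (- u x) \<partial>M) < \<infinity>)"

text \<open>
  For \<open>g \<ge> 0\<close> integrable with respect to a probability measure, the negative part of
  \<open>g * ln g\<close> is integrable, so this is a number in \<open>[0, \<infinity>]\<close>.
\<close>

definition Ent :: "'a measure \<Rightarrow> ('a \<Rightarrow> real) \<Rightarrow> ereal" where
  "Ent \<mu> g = ext_integral \<mu> (\<lambda>x. ereal (g x * ln (g x)))
     - ereal ((\<integral>x. g x \<partial>\<mu>) * ln (\<integral>x. g x \<partial>\<mu>))"

text \<open>
  The library's \<open>KL_divergence\<close> is real-valued (0 when the log-density is not integrable), hence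
  unsuitable here. The points where \<open>RN_deriv\<close> is 0 or infinite are \<open>\<nu>\<close>-null.
\<close>

definition rel_entropy :: "'a measure \<Rightarrow> 'a measure \<Rightarrow> ereal" where
  "rel_entropy \<nu> \<mu> =
     (if absolutely_continuous \<mu> \<nu>
      then ext_integral \<nu> (\<lambda>x. ereal (ln (enn2real (RN_deriv \<mu> \<nu> x))))
      else \<infinity>)"

definition borel_prob :: "'a::topological_space measure \<Rightarrow> bool" where
  "borel_prob \<mu> \<longleftrightarrow> prob_space \<mu> \<and> sets \<mu> = sets borel"

definition couplings ::
  "'a::topological_space measure \<Rightarrow> 'a measure \<Rightarrow> ('a \<times> 'a) measure set" where
  "couplings \<nu> \<mu> = {\<pi>. prob_space \<pi> \<and> sets \<pi> = sets (borel \<Otimes>\<^sub>M borel) \<and>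
     distr \<pi> borel fst = \<nu> \<and> distr \<pi> borel snd = \<mu>}"

definition transport_cost ::
  "('a::topological_space \<Rightarrow> 'a \<Rightarrow> real) \<Rightarrow> 'a measure \<Rightarrow> 'a measure \<Rightarrow> ennreal" where
  "transport_cost c \<nu> \<mu> = (INF \<pi>\<in>couplings \<nu> \<mu>. \<integral>\<^sup>+ (x, y). ennreal (c x y) \<partial>\<pi>)"

definition transport_entropy_ineq ::
  "('a::topological_space \<Rightarrow> 'a \<Rightarrow> real) \<Rightarrow> real \<Rightarrow> 'a measure \<Rightarrow> bool" where
  "transport_entropy_ineq c C \<mu> \<longleftrightarrow>
     (\<forall>\<nu>. borel_prob \<nu> \<longrightarrow> enn2ereal (transport_cost c \<nu> \<mu>) \<le> ereal C * rel_entropy \<nu> \<mu>)"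

definition sup_conv :: "('a \<Rightarrow> 'a \<Rightarrow> real) \<Rightarrow> real \<Rightarrow> ('a \<Rightarrow> real) \<Rightarrow> 'a \<Rightarrow> ereal" where
  "sup_conv c l f x = (SUP y. ereal (f y - l * c x y))"

definition conj_cost :: "('v::real_inner \<Rightarrow> real) \<Rightarrow> 'v \<Rightarrow> ereal" where
  "conj_cost c u = (SUP h. ereal (u \<bullet> h - c h))"

definition semi_convex :: "real \<Rightarrow> ('v::real_vector \<Rightarrow> real) \<Rightarrow> ('v \<Rightarrow> real) \<Rightarrow> bool" where
  "semi_convex K c g \<longleftrightarrow> (\<forall>l\<in>{0..1}. \<forall>x y.
     g (l *\<^sub>R x + (1 - l) *\<^sub>R y) \<le> l * g x + (1 - l) * g y
       + l * K * c ((1 - l) *\<^sub>R (y - x)) + (1 - l) * K * c (l *\<^sub>R (y - x)))"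

definition semi_concave :: "real \<Rightarrow> ('v::real_vector \<Rightarrow> real) \<Rightarrow> ('v \<Rightarrow> real) \<Rightarrow> bool" where
  "semi_concave K c f \<longleftrightarrow> semi_convex K c (\<lambda>x. - f x)"

definition grad :: "('v::real_inner \<Rightarrow> real) \<Rightarrow> 'v \<Rightarrow> 'v" where
  "grad f x = (THE D. GDERIV f x :> D)"

end

theory Submission
  imports Defs
begin

text \<open>
  The transport-entropy inequality is applied to a single measure, the Gibbs measure
  \<open>\<nu> = (e^f / Z) \<mu>\<close> with \<open>Z = \<integral> e^f d\<mu>\<close>. Its relative entropy is
  \<open>H = \<integral> f d\<nu> - ln Z = Ent(e^f) / Z\<close>, and Jensen's inequality \<open>\<integral> f d\<mu> \<le> ln Z\<close> gives
  \<open>H \<le> \<integral> f d\<nu> - \<integral> f d\<mu>\<close>. For a coupling \<open>\<pi>\<close> of \<open>\<nu>\<close> and \<open>\<mu>\<close> the right-hand side is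
  \<open>\<integral> (f x - f y) d\<pi>(x, y)\<close>, and \<open>f x - f y \<le> (P f y - f y) + l c(x, y)\<close> by the definition of the
  sup-convolution \<open>P f\<close>. Taking the infimum over \<open>\<pi>\<close>, \<open>H \<le> \<integral> (P f - f) d\<mu> + l C H\<close>, and the
  last term is absorbed into the left-hand side since \<open>l C < 1\<close>.

  Two points of integrability need care. The absorption requires \<open>H < \<infinity>\<close>. Truncating \<open>f\<close> from
  above at \<open>n\<close> makes the entropy finite, and for the truncated function the difference of
  sup-convolution and function is at most the positive part of \<open>P f - f\<close>. So the
  argument bounds the entropies of the truncations uniformly in \<open>n\<close>, and monotone convergence
  bounds the entropy of \<open>e^f\<close> (\<open>integrable_mult_exp_of_transport_entropy\<close>). The integral of \<open>f\<close> against \<open>\<mu>\<close> could also be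
  \<open>-\<infinity>\<close>; but once \<open>H\<close> is finite there is a coupling of finite cost, and it transfers
  integrability of \<open>f\<close> from \<open>\<nu>\<close> to \<open>\<mu>\<close> (\<open>integral_diff_le_of_coupling\<close>).

  The gradient form is a consequence of the sup-convolution form with \<open>l = \<eta> + K\<close>: a
  differentiable \<open>K\<close>-semi-concave function lies below its tangents up to \<open>K c(y - x)\<close>
  (\<open>semi_concave_le_tangent\<close>), so that
  \<open>f y - f x - l c(x - y) \<le> \<nabla>f(x) \<bullet> (y - x) - \<eta> c(y - x)\<close>, and the supremum over \<open>y\<close> of the
  right-hand side is \<open>\<eta> c*(\<nabla>f(x) / \<eta>)\<close>.
\<close>

section \<open>Integrals with values in the extended reals\<close>

lemma ext_integral_real:
  assumes "integrable M f"
  shows "ext_integral M (\<lambda>x. ereal (f x)) = ereal (\<integral>x. f x \<partial>M)"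
proof -
  have a: "(\<integral>\<^sup>+ x. ennreal (f x) \<partial>M) \<noteq> \<infinity>" "(\<integral>\<^sup>+ x. ennreal (- f x) \<partial>M) \<noteq> \<infinity>"
    using assms by (auto simp: real_integrable_def)
  then obtain p q where pq: "(\<integral>\<^sup>+ x. ennreal (f x) \<partial>M) = ennreal p" "p \<ge> 0"
      "(\<integral>\<^sup>+ x. ennreal (- f x) \<partial>M) = ennreal q" "q \<ge> 0"
    by (metis ennreal_cases infinity_ennreal_def)
  show ?thesis
    by (simp add: ext_integral_def real_lebesgue_integral_def[OF assms] pq)
qed

lemma ext_integral_cong_AE:
  assumes "AE x in M. u x = v x"
  shows "ext_integral M u = ext_integral M v"
proof -
  have "(\<integral>\<^sup>+ x. e2ennreal (u x) \<partial>M) = (\<integral>\<^sup>+ x. e2ennreal (v x) \<partial>M)"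
       "(\<integral>\<^sup>+ x. e2ennreal (- u x) \<partial>M) = (\<integral>\<^sup>+ x. e2ennreal (- v x) \<partial>M)"
    by (intro nn_integral_cong_AE; use assms in eventually_elim, simp)+
  then show ?thesis by (simp add: ext_integral_def)
qed

lemma ext_integral_completion: "ext_integral (completion M) u = ext_integral M u"
  by (simp add: ext_integral_def nn_integral_completion)

lemma ext_integral_nonneg:
  assumes "\<And>x. 0 \<le> u x"
  shows "ext_integral M u = enn2ereal (\<integral>\<^sup>+ x. e2ennreal (u x) \<partial>M)"
  by (simp add: ext_integral_def e2ennreal_neg assms zero_ennreal.rep_eq)

section \<open>Gibbs measures\<close>

definition gibbs :: "'a measure \<Rightarrow> ('a \<Rightarrow> real) \<Rightarrow> 'a measure" where
  "gibbs \<mu> f = density \<mu> (\<lambda>x. ennreal (exp (f x) / (\<integral>y. exp (f y) \<partial>\<mu>)))"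

lemma integral_exp_pos:
  fixes f :: "'a \<Rightarrow> real"
  assumes "prob_space M" "integrable M (\<lambda>x. exp (f x))"
  shows "0 < (\<integral>x. exp (f x) \<partial>M)"
proof -
  interpret prob_space M by fact
  have "(\<integral>x. exp (f x) \<partial>M) \<noteq> 0"
  proof
    assume "(\<integral>x. exp (f x) \<partial>M) = 0"
    then have "AE x in M. exp (f x) = 0"
      using integral_nonneg_eq_0_iff_AE[OF assms(2)] by simp
    then show False using not_AE_zero_E prob_space by (auto simp: emeasure_space_1 AE_False)
  qed
  moreover have "(\<integral>x. exp (f x) \<partial>M) \<ge> 0" by simp
  ultimately show ?thesis by linarith
qed

lemma borel_probD:
  assumes "borel_prob \<mu>"
  shows "prob_space \<mu>" "sets \<mu> = sets borel" "space \<mu> = UNIV"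
  using assms sets_eq_imp_space_eq[of \<mu> borel] by (auto simp: borel_prob_def)

text \<open>
  The first factor of \<open>f * exp f\<close> is the log-density up to the constant \<open>ln Z\<close>, so the
  integrability of this product says exactly that the Gibbs measure has finite relative entropy.
\<close>

lemma gibbs_properties:
  assumes \<mu>: "borel_prob \<mu>" and f: "f \<in> borel_measurable borel"
    and int: "integrable \<mu> (\<lambda>x. exp (f x))" "integrable \<mu> (\<lambda>x. f x * exp (f x))"
  defines "Z \<equiv> \<integral>x. exp (f x) \<partial>\<mu>"
  shows "borel_prob (gibbs \<mu> f)"
    and "integrable (gibbs \<mu> f) f"
    and "(\<integral>x. f x \<partial>gibbs \<mu> f) = (\<integral>x. f x * exp (f x) \<partial>\<mu>) / Z"
    and "rel_entropy (gibbs \<mu> f) \<mu> = ereal ((\<integral>x. f x \<partial>gibbs \<mu> f) - ln Z)"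
proof -
  interpret prob_space \<mu> using borel_probD(1)[OF \<mu>] .
  note [measurable_cong] = borel_probD(2)[OF \<mu>]
  note [measurable] = f
  have Z: "Z > 0" unfolding Z_def by (rule integral_exp_pos) (fact prob_space_axioms, fact int(1))
  let ?\<nu> = "gibbs \<mu> f"
  have \<nu>: "?\<nu> = density \<mu> (\<lambda>x. ennreal (exp (f x) / Z))" by (simp add: gibbs_def Z_def)
  have "(\<integral>\<^sup>+x. ennreal (exp (f x) / Z) \<partial>\<mu>) = ennreal (\<integral>x. exp (f x) / Z \<partial>\<mu>)"
    by (rule nn_integral_eq_integral) (use int Z in auto)
  also have "\<dots> = 1" using Z by (simp add: Z_def)
  finally have one: "(\<integral>\<^sup>+x. ennreal (exp (f x) / Z) \<partial>\<mu>) = 1" .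
  have ps: "prob_space ?\<nu>"
    unfolding \<nu> by (rule prob_spaceI) (simp add: emeasure_density one)
  show bp: "borel_prob ?\<nu>" using ps by (simp add: borel_prob_def \<nu> borel_probD(2)[OF \<mu>])
  show intf: "integrable ?\<nu> f"
    unfolding \<nu> using Z int(2) by (subst integrable_density) (auto simp: mult.commute)
  show "(\<integral>x. f x \<partial>?\<nu>) = (\<integral>x. f x * exp (f x) \<partial>\<mu>) / Z"
    unfolding \<nu> using Z by (subst integral_density) (auto simp: mult.commute)
  have "AE x in \<mu>. ennreal (exp (f x) / Z) = RN_deriv \<mu> ?\<nu> x"
    by (rule RN_deriv_unique) (simp_all add: \<nu>)
  then have "AE x in \<mu>. ereal (ln (enn2real (RN_deriv \<mu> ?\<nu> x))) = ereal (f x - ln Z)"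
  proof eventually_elim
    case (elim x)
    then show ?case using Z by (simp add: elim[symmetric] ln_div)
  qed
  then have ae: "AE x in ?\<nu>. ereal (ln (enn2real (RN_deriv \<mu> ?\<nu> x))) = ereal (f x - ln Z)"
    unfolding \<nu> by (subst AE_density) auto
  have ac: "absolutely_continuous \<mu> ?\<nu>"
    unfolding \<nu> by (rule absolutely_continuousI_density) simp
  interpret \<nu>: prob_space ?\<nu> by fact
  have "rel_entropy ?\<nu> \<mu> = ext_integral ?\<nu> (\<lambda>x. ereal (f x - ln Z))"
    using ac by (simp add: rel_entropy_def ext_integral_cong_AE[OF ae])
  also have "\<dots> = ereal (\<integral>x. f x - ln Z \<partial>?\<nu>)"
    by (rule ext_integral_real) (use intf in simp)
  also have "(\<integral>x. f x - ln Z \<partial>?\<nu>) = (\<integral>x. f x \<partial>?\<nu>) - ln Z"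
    using intf by (simp add: \<nu>.prob_space)
  finally show "rel_entropy ?\<nu> \<mu> = ereal ((\<integral>x. f x \<partial>?\<nu>) - ln Z)" .
qed

section \<open>Entropy bound for the Gibbs measure\<close>

text \<open>
  The pointwise bound on \<open>f x - f y\<close> is integrated against the coupling. It also shows that
  \<open>-f y \<le> -f x + u y + l c(x, y)\<close>, whose right-hand side has an integrable positive part; this
  rules out \<open>\<integral> f d\<mu> = -\<infinity>\<close>. The same inequality, read as a lower bound for \<open>u\<close>, gives the
  integrability of the negative part of \<open>u\<close>.
\<close>

lemma integral_diff_le_of_coupling:
  fixes f u :: "'a::polish_space \<Rightarrow> real"
  assumes \<mu>: "borel_prob \<mu>" and \<pi>: "\<pi> \<in> couplings \<nu> \<mu>"
    and [measurable]: "(\<lambda>(x, y). c x y) \<in> borel_measurable borel"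
      "f \<in> borel_measurable borel" "u \<in> borel_measurable borel"
    and c: "\<And>x y. 0 \<le> c x y" and l: "0 \<le> l"
    and B: "0 \<le> B" "(\<integral>\<^sup>+ (x, y). ennreal (c x y) \<partial>\<pi>) \<le> ennreal B"
    and f\<nu>: "integrable \<nu> f" and fpos: "integrable \<mu> (\<lambda>x. max 0 (f x))"
    and upos: "integrable \<mu> (\<lambda>x. max 0 (u x))"
    and le: "AE y in \<mu>. \<forall>x. f x - f y \<le> u y + l * c x y"
  shows "integrable \<mu> f" "integrable \<mu> u"
    and "(\<integral>x. f x \<partial>\<nu>) - (\<integral>x. f x \<partial>\<mu>) \<le> (\<integral>x. u x \<partial>\<mu>) + l * B"
proof -
  have \<pi>': "prob_space \<pi>" and s: "sets \<pi> = sets (borel \<Otimes>\<^sub>M borel)"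
    and d1: "\<nu> = distr \<pi> borel fst" and d2: "\<mu> = distr \<pi> borel snd"
    using \<pi> by (auto simp: couplings_def)
  have s': "sets \<pi> = sets borel" unfolding s by (subst borel_prod) (rule refl)
  interpret prob_space \<pi> by fact
  note [measurable_cong] = s
  have [measurable]: "(\<lambda>p. c (fst p) (snd p)) \<in> borel_measurable \<pi>"
    using assms(3) measurable_cong_sets[OF s' refl] by (auto simp: case_prod_beta')
  have [measurable]: "fst \<in> \<pi> \<rightarrow>\<^sub>M borel" "snd \<in> \<pi> \<rightarrow>\<^sub>M borel"
    by (simp_all add: measurable_cong_sets[OF s refl])
  have cost: "(\<integral>\<^sup>+ p. ennreal (c (fst p) (snd p)) \<partial>\<pi>) \<le> ennreal B"
    using B(2) by (simp add: case_prod_beta')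
  have ic: "integrable \<pi> (\<lambda>p. c (fst p) (snd p))"
    by (rule integrableI_nonneg) (use le_less_trans[OF cost] c in auto)
  have cB: "(\<integral>p. c (fst p) (snd p) \<partial>\<pi>) \<le> B"
  proof -
    have "ennreal (\<integral>p. c (fst p) (snd p) \<partial>\<pi>) \<le> ennreal B"
      using cost by (subst nn_integral_eq_integral[OF ic, symmetric]) (auto simp: c)
    then show ?thesis using B(1) by simp
  qed
  have if1: "integrable \<pi> (\<lambda>p. f (fst p))"
    using f\<nu> unfolding d1 by (subst (asm) integrable_distr_eq) auto
  have tr: "integrable \<mu> g \<longleftrightarrow> integrable \<pi> (\<lambda>p. g (snd p))"
    if [measurable]: "g \<in> borel_measurable borel" for g :: "'a \<Rightarrow> real"
    unfolding d2 by (subst integrable_distr_eq) auto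
  have up: "integrable \<pi> (\<lambda>p. max 0 (u (snd p)))" using upos by (subst (asm) tr) auto
  have fp: "integrable \<pi> (\<lambda>p. max 0 (f (snd p)))" using fpos by (subst (asm) tr) auto
  have ae: "AE p in \<pi>. f (fst p) - f (snd p) \<le> u (snd p) + l * c (fst p) (snd p)"
  proof -
    have "AE p in \<pi>. \<forall>x. f x - f (snd p) \<le> u (snd p) + l * c x (snd p)"
      by (rule AE_distrD[where M'=borel]) (use le d2 in auto)
    then show ?thesis by eventually_elim auto
  qed
  have if2: "integrable \<pi> (\<lambda>p. f (snd p))"
  proof (rule Bochner_Integration.integrable_bound)
    show "integrable \<pi> (\<lambda>p. \<bar>f (fst p)\<bar> + max 0 (f (snd p)) + max 0 (u (snd p))
        + l * c (fst p) (snd p))"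
      using if1 up fp ic by (intro Bochner_Integration.integrable_add integrable_abs) auto
    show "AE p in \<pi>. norm (f (snd p)) \<le> norm (\<bar>f (fst p)\<bar> + max 0 (f (snd p))
        + max 0 (u (snd p)) + l * c (fst p) (snd p))"
      using ae
    proof eventually_elim
      case (elim p)
      have "0 \<le> l * c (fst p) (snd p)" using c l by simp
      with elim show ?case by simp
    qed
  qed simp
  have iu: "integrable \<pi> (\<lambda>p. u (snd p))"
  proof (rule Bochner_Integration.integrable_bound)
    show "integrable \<pi> (\<lambda>p. \<bar>f (fst p)\<bar> + \<bar>f (snd p)\<bar> + max 0 (u (snd p))
        + l * c (fst p) (snd p))"
      using if1 up if2 ic by (intro Bochner_Integration.integrable_add integrable_abs) auto
    show "AE p in \<pi>. norm (u (snd p)) \<le> norm (\<bar>f (fst p)\<bar> + \<bar>f (snd p)\<bar>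
        + max 0 (u (snd p)) + l * c (fst p) (snd p))"
      using ae
    proof eventually_elim
      case (elim p)
      have "0 \<le> l * c (fst p) (snd p)" using c l by simp
      with elim show ?case by simp
    qed
  qed simp
  show "integrable \<mu> f" "integrable \<mu> u" using if2 iu tr by auto
  have "(\<integral>p. f (fst p) - f (snd p) \<partial>\<pi>) \<le> (\<integral>p. u (snd p) + l * c (fst p) (snd p) \<partial>\<pi>)"
    by (rule integral_mono_AE) (use if1 if2 iu ic ae in auto)
  also have "\<dots> = (\<integral>p. u (snd p) \<partial>\<pi>) + l * (\<integral>p. c (fst p) (snd p) \<partial>\<pi>)"
    using iu ic by simp
  also have "\<dots> \<le> (\<integral>p. u (snd p) \<partial>\<pi>) + l * B"
    using cB l by (simp add: mult_left_mono)
  also have "(\<integral>p. u (snd p) \<partial>\<pi>) = (\<integral>x. u x \<partial>\<mu>)"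
    unfolding d2 by (subst integral_distr) auto
  also have "(\<integral>p. f (fst p) - f (snd p) \<partial>\<pi>) = (\<integral>x. f x \<partial>\<nu>) - (\<integral>x. f x \<partial>\<mu>)"
    using if1 if2 unfolding d1 d2 by (simp add: integral_distr)
  finally show "(\<integral>x. f x \<partial>\<nu>) - (\<integral>x. f x \<partial>\<mu>) \<le> (\<integral>x. u x \<partial>\<mu>) + l * B" .
qed

text \<open>
  Jensen's inequality for the exponential, from \<open>1 + t \<le> e^t\<close> at \<open>t = f x - ln Z\<close>.
\<close>

lemma integral_le_ln_integral_exp:
  fixes f :: "'a \<Rightarrow> real"
  assumes "prob_space M" "integrable M f" "integrable M (\<lambda>x. exp (f x))"
  shows "(\<integral>x. f x \<partial>M) \<le> ln (\<integral>x. exp (f x) \<partial>M)"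
proof -
  interpret prob_space M by fact
  let ?Z = "\<integral>x. exp (f x) \<partial>M"
  have Z: "?Z > 0" using integral_exp_pos assms(1,3) .
  have "(\<integral>x. f x - ln ?Z + 1 \<partial>M) \<le> (\<integral>x. exp (f x) / ?Z \<partial>M)"
  proof (rule integral_mono)
    fix x
    have "1 + (f x - ln ?Z) \<le> exp (f x - ln ?Z)" by (rule exp_ge_add_one_self)
    also have "\<dots> = exp (f x) / ?Z" using Z by (simp add: exp_diff)
    finally show "f x - ln ?Z + 1 \<le> exp (f x) / ?Z" by simp
  qed (use assms in auto)
  then show ?thesis using Z assms by (simp add: prob_space)
qed

text \<open>
  The function \<open>u\<close> is to be a Borel version of \<open>P f - f\<close>, but any almost-everywhere bound of this
  form suffices, and this freedom is what makes truncation of \<open>f\<close> possible below. The infimum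
  defining the transport cost need not be attained, hence couplings of cost at most \<open>C H + e\<close>.
\<close>

lemma rel_entropy_gibbs_le:
  fixes f u :: "'a::polish_space \<Rightarrow> real"
  assumes \<mu>: "borel_prob \<mu>" and T: "transport_entropy_ineq c C \<mu>"
    and c_meas: "(\<lambda>(x, y). c x y) \<in> borel_measurable borel"
    and c: "\<And>x y. 0 \<le> c x y" and l: "0 < l" "l * C < 1"
    and f: "f \<in> borel_measurable borel" and u: "u \<in> borel_measurable borel"
    and int: "integrable \<mu> (\<lambda>x. exp (f x))" "integrable \<mu> (\<lambda>x. f x * exp (f x))"
    and upos: "integrable \<mu> (\<lambda>x. max 0 (u x))"
    and le: "AE y in \<mu>. \<forall>x. f x - f y \<le> u y + l * c x y"
  defines "Z \<equiv> \<integral>x. exp (f x) \<partial>\<mu>"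
  shows "integrable \<mu> u"
    and "(\<integral>x. f x * exp (f x) \<partial>\<mu>) / Z - ln Z \<le> (\<integral>x. u x \<partial>\<mu>) / (1 - l * C)"
proof -
  note g = gibbs_properties[OF \<mu> f int, folded Z_def]
  let ?\<nu> = "gibbs \<mu> f"
  define H where "H = (\<integral>x. f x \<partial>?\<nu>) - ln Z"
  note [measurable_cong] = borel_probD(2)[OF \<mu>]
  note [measurable] = f
  have TH: "enn2ereal (transport_cost c ?\<nu> \<mu>) \<le> ereal (C * H)"
  proof -
    have "enn2ereal (transport_cost c ?\<nu> \<mu>) \<le> ereal C * rel_entropy ?\<nu> \<mu>"
      using T g(1) unfolding transport_entropy_ineq_def by blast
    then show ?thesis by (simp add: g(4) H_def)
  qed
  moreover have "0 \<le> enn2ereal (transport_cost c ?\<nu> \<mu>)" by simp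
  ultimately have "0 \<le> ereal (C * H)" by (rule order_trans[rotated])
  then have CH: "0 \<le> C * H" by simp
  have cost: "transport_cost c ?\<nu> \<mu> \<le> ennreal (C * H)"
    using e2ennreal_mono[OF TH] by simp
  have fpos: "integrable \<mu> (\<lambda>x. max 0 (f x))"
  proof (rule Bochner_Integration.integrable_bound[OF int(1)])
    show "AE x in \<mu>. norm (max 0 (f x)) \<le> norm (exp (f x))"
    proof (rule AE_I2)
      fix x
      show "norm (max 0 (f x)) \<le> norm (exp (f x))"
        using exp_ge_add_one_self[of "f x"] exp_gt_zero[of "f x"] unfolding real_norm_def by linarith
    qed
  qed simp
  have key: "integrable \<mu> f \<and> integrable \<mu> u \<and>
      (\<integral>x. f x \<partial>?\<nu>) - (\<integral>x. f x \<partial>\<mu>) \<le> (\<integral>x. u x \<partial>\<mu>) + l * (C * H + e)" if "e > 0" for e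
  proof -
    have "ennreal (C * H) < ennreal (C * H + e)" using CH that by (simp add: ennreal_less_iff)
    then have "transport_cost c ?\<nu> \<mu> < ennreal (C * H + e)" by (rule le_less_trans[OF cost])
    then obtain \<pi> where \<pi>: "\<pi> \<in> couplings ?\<nu> \<mu>"
        and B: "(\<integral>\<^sup>+ (x, y). ennreal (c x y) \<partial>\<pi>) < ennreal (C * H + e)"
      unfolding transport_cost_def INF_less_iff by blast
    have Be: "0 \<le> C * H + e" using CH that by simp
    have l0: "0 \<le> l" using l by simp
    note cb = integral_diff_le_of_coupling[OF \<mu> \<pi> c_meas f u c l0 Be less_imp_le[OF B] g(2) fpos upos le]
    show ?thesis by (intro conjI cb)
  qed
  have intf: "integrable \<mu> f" using key[of 1] by simp
  show "integrable \<mu> u" using key[of 1] by simp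
  have jensen: "(\<integral>x. f x \<partial>\<mu>) \<le> ln Z"
    unfolding Z_def using integral_le_ln_integral_exp borel_probD(1)[OF \<mu>] intf int(1) .
  have "H * (1 - l * C) \<le> (\<integral>x. u x \<partial>\<mu>)"
  proof (rule field_le_epsilon)
    fix e :: real assume e: "0 < e"
    have "H \<le> (\<integral>x. f x \<partial>?\<nu>) - (\<integral>x. f x \<partial>\<mu>)" using jensen by (simp add: H_def)
    also have "\<dots> \<le> (\<integral>x. u x \<partial>\<mu>) + l * (C * H + e / l)"
      using key[of "e / l"] e l by simp
    also have "\<dots> = (\<integral>x. u x \<partial>\<mu>) + l * C * H + e" using l by (simp add: field_simps)
    finally show "H * (1 - l * C) \<le> (\<integral>x. u x \<partial>\<mu>) + e" by (simp add: algebra_simps)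
  qed
  then have "H \<le> (\<integral>x. u x \<partial>\<mu>) / (1 - l * C)" using l by (simp add: pos_le_divide_eq)
  then show "(\<integral>x. f x * exp (f x) \<partial>\<mu>) / Z - ln Z \<le> (\<integral>x. u x \<partial>\<mu>) / (1 - l * C)"
    by (simp add: H_def g(3))
qed

lemma mult_exp_ge_minus_1: "- 1 \<le> t * exp (t :: real)"
proof -
  have "- t \<le> exp (- t)" using exp_ge_add_one_self[of "- t"] by simp
  then have "- t * exp t \<le> exp (- t) * exp t" by (intro mult_right_mono) auto
  then show ?thesis by (simp add: exp_minus)
qed

lemma max_0_mult_exp_mono: "s \<le> t \<Longrightarrow> max 0 (s * exp s) \<le> max 0 (t * exp (t :: real))"
  by (cases "0 \<le> s") (auto simp: max_def mult_le_0_iff zero_le_mult_iff intro: mult_mono)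

text \<open>
  Finiteness of the entropy. The map \<open>t \<mapsto> min t n\<close> is monotone and 1-Lipschitz, so \<open>min f n\<close>
  satisfies the same pointwise bound as \<open>f\<close> with \<open>max 0 u\<close> in place of \<open>u\<close>. The resulting bound on
  its entropy depends on \<open>n\<close> only through the normalising constant, which is at most that of \<open>f\<close>.
\<close>

lemma integrable_mult_exp_of_transport_entropy:
  fixes f u :: "'a::polish_space \<Rightarrow> real"
  assumes \<mu>: "borel_prob \<mu>" and T: "transport_entropy_ineq c C \<mu>"
    and c_meas: "(\<lambda>(x, y). c x y) \<in> borel_measurable borel"
    and c: "\<And>x y. 0 \<le> c x y" and l: "0 < l" "l * C < 1"
    and f: "f \<in> borel_measurable borel" and u: "u \<in> borel_measurable borel"
    and int: "integrable \<mu> (\<lambda>x. exp (f x))"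
    and upos: "integrable \<mu> (\<lambda>x. max 0 (u x))"
    and le: "AE y in \<mu>. \<forall>x. f x - f y \<le> u y + l * c x y"
  shows "integrable \<mu> (\<lambda>x. f x * exp (f x))"
proof -
  interpret prob_space \<mu> using borel_probD(1)[OF \<mu>] .
  note [measurable_cong] = borel_probD(2)[OF \<mu>]
  note [measurable] = f u
  define g where "g n x = min (f x) (real n)" for n x
  have [measurable]: "g n \<in> borel_measurable borel" for n unfolding g_def by measurable
  define Z where "Z = (\<integral>x. exp (f x) \<partial>\<mu>)"
  define K where "K = (\<integral>x. max 0 (u x) \<partial>\<mu>) / (1 - l * C)"
  define M where "M = Z * (K + \<bar>ln Z\<bar>) + 1"
  have K: "0 \<le> K" unfolding K_def using l by (intro divide_nonneg_nonneg integral_nonneg) auto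
  have bound: "integrable \<mu> (\<lambda>x. g n x * exp (g n x)) \<and> (\<integral>x. g n x * exp (g n x) \<partial>\<mu>) + 1 \<le> M" for n
  proof -
    define Zn where "Zn = (\<integral>x. exp (g n x) \<partial>\<mu>)"
    have i1: "integrable \<mu> (\<lambda>x. exp (g n x))"
      by (rule Bochner_Integration.integrable_bound[OF int]) (auto simp: g_def)
    have i2: "integrable \<mu> (\<lambda>x. g n x * exp (g n x))"
    proof (rule integrable_const_bound[where B="real n * exp (real n) + 1"])
      show "AE x in \<mu>. norm (g n x * exp (g n x)) \<le> real n * exp (real n) + 1"
      proof (rule AE_I2)
        fix x
        have "max 0 (g n x * exp (g n x)) \<le> max 0 (real n * exp (real n))"
          by (rule max_0_mult_exp_mono) (simp add: g_def)
        then show "norm (g n x * exp (g n x)) \<le> real n * exp (real n) + 1"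
          using mult_exp_ge_minus_1[of "g n x"] mult_nonneg_nonneg[of "real n" "exp (real n)"]
          unfolding real_norm_def by (simp del: zero_le_mult_iff mult_nonneg_nonneg)
      qed
    qed simp
    have "AE y in \<mu>. \<forall>x. g n x - g n y \<le> max 0 (u y) + l * c x y"
      using le
    proof eventually_elim
      case (elim y)
      show ?case
      proof
        fix x
        have "0 \<le> l * c x y" using c l by simp
        moreover have "f x - f y \<le> u y + l * c x y" using elim by simp
        ultimately show "g n x - g n y \<le> max 0 (u y) + l * c x y"
          by (auto simp: g_def min_def max_def)
      qed
    qed
    then have "(\<integral>x. g n x * exp (g n x) \<partial>\<mu>) / Zn - ln Zn \<le> K"
      unfolding K_def Zn_def
      by (intro rel_entropy_gibbs_le(2)[OF \<mu> T c_meas c l]) (use i1 i2 upos in auto)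
    moreover have Zn: "0 < Zn"
      unfolding Zn_def using integral_exp_pos prob_space_axioms i1 .
    moreover have ZnZ: "Zn \<le> Z"
      unfolding Zn_def Z_def by (rule integral_mono) (use i1 int in \<open>auto simp: g_def\<close>)
    ultimately have "(\<integral>x. g n x * exp (g n x) \<partial>\<mu>) \<le> (K + ln Zn) * Zn"
      by (simp add: field_simps)
    also have "\<dots> \<le> (K + \<bar>ln Z\<bar>) * Z"
    proof (rule mult_mono)
      have "ln Zn \<le> ln Z" using Zn ZnZ by simp
      then show "K + ln Zn \<le> K + \<bar>ln Z\<bar>" by simp
    qed (use K Zn ZnZ in auto)
    finally show ?thesis using i2 by (simp add: M_def mult.commute)
  qed
  have "(\<integral>\<^sup>+x. ennreal (max 0 (f x * exp (f x))) \<partial>\<mu>) \<le>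
      (\<integral>\<^sup>+x. (SUP n. ennreal (max 0 (g n x * exp (g n x)))) \<partial>\<mu>)"
  proof (rule nn_integral_mono)
    fix x
    obtain n where "f x \<le> real n" using real_arch_simple by blast
    then have "g n x = f x" by (simp add: g_def)
    then show "ennreal (max 0 (f x * exp (f x))) \<le> (SUP n. ennreal (max 0 (g n x * exp (g n x))))"
      by (intro SUP_upper2[of n]) auto
  qed
  \<comment> \<open>The function \<open>t e^t\<close> itself is not monotone; its positive part is.\<close>
  also have "\<dots> = (SUP n. \<integral>\<^sup>+x. ennreal (max 0 (g n x * exp (g n x))) \<partial>\<mu>)"
  proof (rule nn_integral_monotone_convergence_SUP)
    show "incseq (\<lambda>n x. ennreal (max 0 (g n x * exp (g n x))))"
      unfolding incseq_def le_fun_def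
      by (intro allI impI ennreal_leI max_0_mult_exp_mono) (auto simp: g_def min_def)
  qed simp
  also have "\<dots> \<le> ennreal M"
  proof (rule SUP_least)
    fix n
    have "(\<integral>\<^sup>+x. ennreal (max 0 (g n x * exp (g n x))) \<partial>\<mu>) \<le>
        (\<integral>\<^sup>+x. ennreal (g n x * exp (g n x) + 1) \<partial>\<mu>)"
    proof (intro nn_integral_mono ennreal_leI)
      fix x
      show "max 0 (g n x * exp (g n x)) \<le> g n x * exp (g n x) + 1"
        using mult_exp_ge_minus_1[of "g n x"] by linarith
    qed
    also have "\<dots> = ennreal (\<integral>x. g n x * exp (g n x) + 1 \<partial>\<mu>)"
    proof (rule nn_integral_eq_integral)
      show "AE x in \<mu>. 0 \<le> g n x * exp (g n x) + 1"
        using mult_exp_ge_minus_1 by (intro AE_I2) (smt (verit))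
    qed (use bound[of n] in simp)
    also have "\<dots> \<le> ennreal M" using bound[of n] by (intro ennreal_leI) (simp add: prob_space)
    finally show "(\<integral>\<^sup>+x. ennreal (max 0 (g n x * exp (g n x))) \<partial>\<mu>) \<le> ennreal M" .
  qed
  finally have fin: "(\<integral>\<^sup>+x. ennreal (max 0 (f x * exp (f x))) \<partial>\<mu>) < \<infinity>"
    by (rule le_less_trans) simp
  have "integrable \<mu> (\<lambda>x. max 0 (f x * exp (f x)))"
    by (rule integrableI_nonneg) (use fin in auto)
  then have i: "integrable \<mu> (\<lambda>x. max 0 (f x * exp (f x)) + 1)" by simp
  show ?thesis
  proof (rule Bochner_Integration.integrable_bound[OF i])
    show "AE x in \<mu>. norm (f x * exp (f x)) \<le> norm (max 0 (f x * exp (f x)) + 1)"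
    proof (rule AE_I2)
      fix x
      show "norm (f x * exp (f x)) \<le> norm (max 0 (f x * exp (f x)) + 1)"
        using mult_exp_ge_minus_1[of "f x"] unfolding real_norm_def by linarith
    qed
  qed simp
qed

section \<open>The inequality with the sup-convolution\<close>

text \<open>
  Only the case where the integral of \<open>w = P f - f\<close> is not \<open>\<infinity>\<close> has content. Then \<open>w < \<infinity>\<close> almost
  everywhere, and \<open>w > -\<infinity>\<close> because \<open>y = x\<close> competes in the supremum; so \<open>w\<close> agrees almost
  everywhere with a real Borel function \<open>u\<close>, although \<open>P f\<close> may fail to be Borel.
\<close>

lemma Ent_exp_le_sup_conv:
  fixes f :: "'a::polish_space \<Rightarrow> real"
  assumes \<mu>: "borel_prob \<mu>" and T: "transport_entropy_ineq c C \<mu>"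
    and c_meas: "(\<lambda>(x, y). c x y) \<in> borel_measurable borel"
    and c: "\<And>x y. 0 \<le> c x y" and sym: "\<And>x y. c x y = c y x"
    and l: "0 < l" "l * C < 1"
    and f: "f \<in> borel_measurable borel"
    and int: "integrable \<mu> (\<lambda>x. exp (f x))"
    and ext: "has_ext_integral (completion \<mu>) (\<lambda>x. sup_conv c l f x - ereal (f x))"
  shows "Ent \<mu> (\<lambda>x. exp (f x)) \<le> ereal (1 / (1 - l * C))
           * ext_integral (completion \<mu>) (\<lambda>x. sup_conv c l f x - ereal (f x))
           * ereal (\<integral>x. exp (f x) \<partial>\<mu>)"
proof -
  interpret prob_space \<mu> using borel_probD(1)[OF \<mu>] .
  define w where "w x = sup_conv c l f x - ereal (f x)" for x
  define Z where "Z = (\<integral>x. exp (f x) \<partial>\<mu>)"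
  have Z: "Z > 0" unfolding Z_def using integral_exp_pos prob_space_axioms int .
  let ?D = "ext_integral (completion \<mu>) w"
  have wm [measurable]: "w \<in> borel_measurable (completion \<mu>)"
    using ext by (simp add: has_ext_integral_def w_def[abs_def])
  \<comment> \<open>Symmetry of the cost: in \<open>P f\<close> the fixed point is its first argument, but in the coupling the
    point distributed according to \<open>\<mu>\<close> is the second one.\<close>
  have w_ge: "ereal (f x - l * c x y - f y) \<le> w y" for x y
  proof -
    have "ereal (f x - l * c y x) \<le> sup_conv c l f y"
      unfolding sup_conv_def by (rule SUP_upper) simp
    then have "ereal (f x - l * c y x) - ereal (f y) \<le> w y"
      unfolding w_def by (intro ereal_minus_mono) auto
    then show ?thesis by (simp add: sym)
  qed
  have "Ent \<mu> (\<lambda>x. exp (f x)) \<le> ereal (1 / (1 - l * C)) * ?D * ereal Z"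
  proof (cases "?D = \<infinity>")
    case True
    then show ?thesis using l Z by simp
  next
    case False
    then have fin: "(\<integral>\<^sup>+ x. e2ennreal (w x) \<partial>completion \<mu>) \<noteq> \<infinity>"
      by (auto simp: ext_integral_def)
    have "AE x in completion \<mu>. e2ennreal (w x) \<noteq> \<infinity>"
      by (rule nn_integral_noteq_infinite) (use fin in auto)
    then have ae1: "AE x in \<mu>. e2ennreal (w x) \<noteq> \<infinity>" by (simp add: AE_completion_iff)
    have "(\<lambda>x. real_of_ereal (w x)) \<in> borel_measurable (completion \<mu>)" by measurable
    from completion_ex_borel_measurable_real[OF this] obtain u
      where um: "u \<in> borel_measurable \<mu>" and ae2: "AE x in \<mu>. real_of_ereal (w x) = u x" by blast
    have u: "u \<in> borel_measurable borel"
      using um measurable_cong_sets[OF borel_probD(2)[OF \<mu>] refl] by blast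
    have wu: "AE x in \<mu>. w x = ereal (u x)"
      using ae1 ae2
    proof eventually_elim
      case (elim x)
      have "w x \<noteq> - \<infinity>" using w_ge[of x x] by auto
      moreover have "w x \<noteq> \<infinity>" using elim(1) by auto
      ultimately show ?case using elim(2) by (cases "w x") auto
    qed
    have "(\<integral>\<^sup>+ x. ennreal (max 0 (u x)) \<partial>\<mu>) = (\<integral>\<^sup>+ x. e2ennreal (w x) \<partial>\<mu>)"
      by (rule nn_integral_cong_AE) (use wu in \<open>eventually_elim, simp add: ennreal_max_0\<close>)
    then have upos: "integrable \<mu> (\<lambda>x. max 0 (u x))"
      using fin um by (intro integrableI_nonneg) (auto simp: nn_integral_completion less_top)
    have le: "AE y in \<mu>. \<forall>x. f x - f y \<le> u y + l * c x y"
      using wu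
    proof eventually_elim
      case (elim y)
      show ?case
      proof
        fix x
        show "f x - f y \<le> u y + l * c x y" using w_ge[of x y] elim by simp
      qed
    qed
    have i: "integrable \<mu> (\<lambda>x. f x * exp (f x))"
      by (rule integrable_mult_exp_of_transport_entropy[OF \<mu> T c_meas c l f u int upos le])
    note r = rel_entropy_gibbs_le[OF \<mu> T c_meas c l f u int i upos le, folded Z_def]
    have D: "?D = ereal (\<integral>x. u x \<partial>\<mu>)"
      by (simp add: ext_integral_completion ext_integral_cong_AE[OF wu] ext_integral_real r(1))
    have "Ent \<mu> (\<lambda>x. exp (f x)) = ereal ((\<integral>x. f x * exp (f x) \<partial>\<mu>) - Z * ln Z)"
      using ext_integral_real[OF i] by (simp add: Ent_def Z_def mult.commute)
    also have "(\<integral>x. f x * exp (f x) \<partial>\<mu>) - Z * ln Z = ((\<integral>x. f x * exp (f x) \<partial>\<mu>) / Z - ln Z) * Z"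
      using Z by (simp add: field_simps)
    also have "ereal \<dots> \<le> ereal ((\<integral>x. u x \<partial>\<mu>) / (1 - l * C) * Z)"
      unfolding ereal_less_eq(3) by (rule mult_right_mono) (use r(2) Z in auto)
    finally show ?thesis by (simp add: D)
  qed
  then show ?thesis by (simp add: w_def[abs_def] Z_def)
qed

section \<open>Semi-concave functions and the convex conjugate of the cost\<close>

lemma GDERIV_grad:
  fixes f :: "'v::euclidean_space \<Rightarrow> real"
  assumes "f differentiable (at x)"
  shows "GDERIV f x :> grad f x"
proof -
  obtain f' where f': "(f has_derivative f') (at x)" using assms by (auto simp: differentiable_def)
  interpret bounded_linear f' using f' by (rule has_derivative_bounded_linear)
  define D where "D = (\<Sum>b\<in>Basis. f' b *\<^sub>R b)"
  have "f' h = h \<bullet> D" for h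
  proof -
    have "f' h = f' (\<Sum>b\<in>Basis. (h \<bullet> b) *\<^sub>R b)" by (simp add: euclidean_representation)
    also have "\<dots> = h \<bullet> D" by (simp add: sum scaleR D_def inner_sum_right mult.commute)
    finally show ?thesis .
  qed
  then have D: "GDERIV f x :> D" using f' unfolding gderiv_def by (metis has_derivative_eq_rhs ext)
  have "E = D" if "GDERIV f x :> E" for E
    using has_derivative_unique[OF that[unfolded gderiv_def] D[unfolded gderiv_def]]
    by (metis inner_commute vector_eq_ldot)
  with D show ?thesis unfolding grad_def by (metis theI)
qed

text \<open>
  Semi-concavity on the segment from \<open>x\<close> to \<open>y = x + h\<close> bounds \<open>f y - f x\<close> by the difference
  quotient of \<open>f\<close> along \<open>h\<close> plus \<open>(1 - t) K c(t h) / t\<close> and \<open>K c((1 - t) h)\<close>. As \<open>t\<close> decreases to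
  0 the first error vanishes since \<open>c\<close> has value and gradient 0 at the origin, and the second
  tends to \<open>K c(h)\<close>.
\<close>

lemma semi_concave_le_tangent:
  fixes f c :: "'v::euclidean_space \<Rightarrow> real"
  assumes f: "f differentiable (at x)" and c: "continuous_on UNIV c"
    and c0: "c differentiable (at 0)" "c 0 = 0" "grad c 0 = 0"
    and sc: "semi_concave K c f"
  shows "f y \<le> f x + grad f x \<bullet> (y - x) + K * c (y - x)"
proof -
  define h where "h = y - x"
  have ray: "((\<lambda>t. (g (z + t *\<^sub>R h) - g z) / t) \<longlongrightarrow> grad g z \<bullet> h) (at_right 0)"
    if "g differentiable (at z)" for g :: "'v \<Rightarrow> real" and z
  proof -
    have "((\<lambda>t::real. z + t *\<^sub>R h) has_derivative (\<lambda>t. t *\<^sub>R h)) (at 0)"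
      by (auto intro!: derivative_eq_intros)
    moreover have "(g has_derivative (\<lambda>v. v \<bullet> grad g z)) (at (z + 0 *\<^sub>R h))"
      using GDERIV_grad[OF that] by (simp add: gderiv_def)
    ultimately have "((\<lambda>t. g (z + t *\<^sub>R h)) has_derivative (\<lambda>t. (t *\<^sub>R h) \<bullet> grad g z)) (at 0)"
      by (rule has_derivative_compose)
    then have "((\<lambda>t. g (z + t *\<^sub>R h)) has_field_derivative (grad g z \<bullet> h)) (at 0)"
      unfolding has_field_derivative_def by (rule has_derivative_eq_rhs) (simp add: fun_eq_iff inner_commute)
    then have "((\<lambda>t. (g (z + t *\<^sub>R h) - g z) / t) \<longlongrightarrow> grad g z \<bullet> h) (at 0)"
      by (simp add: DERIV_def)
    then show ?thesis by (rule filterlim_mono) (auto simp: at_le)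
  qed
  let ?R = "\<lambda>t. (f (x + t *\<^sub>R h) - f x) / t + (1 - t) * K * (c (t *\<^sub>R h) / t) + K * c ((1 - t) *\<^sub>R h)"
  have q: "((\<lambda>t. c (t *\<^sub>R h) / t) \<longlongrightarrow> 0) (at_right 0)"
    using ray[OF c0(1)] c0 by simp
  have "((\<lambda>t. c ((1 - t) *\<^sub>R h)) \<longlongrightarrow> c ((1 - 0) *\<^sub>R h)) (at_right 0)"
    by (rule continuous_on_tendsto_compose[OF c]) (auto intro!: tendsto_eq_intros)
  then have r: "((\<lambda>t. c ((1 - t) *\<^sub>R h)) \<longlongrightarrow> c h) (at_right 0)" by simp
  have "(?R \<longlongrightarrow> grad f x \<bullet> h + (1 - 0) * K * 0 + K * c h) (at_right 0)"
    by (intro tendsto_intros ray f q r)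
  then have lim: "(?R \<longlongrightarrow> grad f x \<bullet> h + K * c h) (at_right 0)" by simp
  have "\<forall>\<^sub>F t in at_right 0. t \<in> {0<..<(1::real)}" by (rule eventually_at_right_real) simp
  then have "\<forall>\<^sub>F t in at_right 0. f y - f x \<le> ?R t"
  proof eventually_elim
    case (elim t)
    then have t: "0 < t" "t < 1" by auto
    have e: "(1 - t) *\<^sub>R x + (1 - (1 - t)) *\<^sub>R y = x + t *\<^sub>R h"
      by (simp add: h_def algebra_simps)
    have "1 - t \<in> {0..1}" using t by simp
    with sc have "- f ((1 - t) *\<^sub>R x + (1 - (1 - t)) *\<^sub>R y) \<le> (1 - t) * - f x + (1 - (1 - t)) * - f y
       + (1 - t) * K * c ((1 - (1 - t)) *\<^sub>R (y - x)) + (1 - (1 - t)) * K * c ((1 - t) *\<^sub>R (y - x))"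
      unfolding semi_concave_def semi_convex_def by blast
    then have "t * (f y - f x) \<le> (f (x + t *\<^sub>R h) - f x) + (1 - t) * K * c (t *\<^sub>R h) + t * K * c ((1 - t) *\<^sub>R h)"
      unfolding e by (simp add: h_def algebra_simps)
    then have "f y - f x \<le> ((f (x + t *\<^sub>R h) - f x) + (1 - t) * K * c (t *\<^sub>R h) + t * K * c ((1 - t) *\<^sub>R h)) / t"
      using t by (simp add: pos_le_divide_eq mult.commute)
    also have "\<dots> = ?R t" using t by (simp add: add_divide_distrib)
    finally show ?case .
  qed
  from tendsto_lowerbound[OF lim this] have "f y - f x \<le> grad f x \<bullet> h + K * c h" by simp
  then show ?thesis by (simp add: h_def)
qed

text \<open>
  The index set may be uncountable: such a supremum is lower semicontinuous.
\<close>

lemma borel_measurable_SUP_continuous: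
  fixes F :: "'i \<Rightarrow> 'a::topological_space \<Rightarrow> ereal"
  assumes "\<And>i. i \<in> I \<Longrightarrow> continuous_on UNIV (F i)"
  shows "(\<lambda>x. SUP i\<in>I. F i x) \<in> borel_measurable borel"
proof (rule borel_measurableI_greater)
  fix a
  have "{x. a < (SUP i\<in>I. F i x)} = (\<Union>i\<in>I. {x. a < F i x})" by (auto simp: less_SUP_iff)
  moreover have "open (\<Union>i\<in>I. {x. a < F i x})"
    using assms by (intro open_UN ballI open_Collect_less) auto
  ultimately show "{x \<in> space borel. a < (SUP i\<in>I. F i x)} \<in> sets borel" by simp
qed

lemma sup_conv_minus_le_conj_cost:
  fixes f c :: "'v::euclidean_space \<Rightarrow> real"
  assumes f: "f differentiable (at x)" and c: "continuous_on UNIV c" and sym: "\<And>x. c (- x) = c x"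
    and c0: "c differentiable (at 0)" "c 0 = 0" "grad c 0 = 0"
    and sc: "semi_concave K c f" and \<eta>: "0 < \<eta>"
  shows "sup_conv (\<lambda>x y. c (x - y)) (\<eta> + K) f x - ereal (f x)
           \<le> ereal \<eta> * conj_cost c ((1 / \<eta>) *\<^sub>R grad f x)"
proof -
  let ?w = "ereal \<eta> * conj_cost c ((1 / \<eta>) *\<^sub>R grad f x)"
  have "sup_conv (\<lambda>x y. c (x - y)) (\<eta> + K) f x \<le> ?w + ereal (f x)"
    unfolding sup_conv_def
  proof (rule SUP_least)
    fix y
    have cxy: "c (x - y) = c (y - x)" using sym[of "y - x"] by simp
    have "f y - (\<eta> + K) * c (x - y) \<le> (f x + grad f x \<bullet> (y - x) + K * c (y - x)) - (\<eta> + K) * c (x - y)"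
      using semi_concave_le_tangent[OF f c c0 sc, of y] by simp
    also have "\<dots> = \<eta> * (((1 / \<eta>) *\<^sub>R grad f x) \<bullet> (y - x) - c (y - x)) + f x"
      using \<eta> by (simp add: cxy algebra_simps)
    finally have "ereal (f y - (\<eta> + K) * c (x - y)) \<le>
        ereal \<eta> * ereal (((1 / \<eta>) *\<^sub>R grad f x) \<bullet> (y - x) - c (y - x)) + ereal (f x)" by simp
    also have "\<dots> \<le> ?w + ereal (f x)"
      unfolding conj_cost_def using \<eta>
      by (intro add_mono ereal_mult_left_mono SUP_upper) auto
    finally show "ereal (f y - (\<eta> + K) * c (x - y)) \<le> ?w + ereal (f x)" .
  qed
  then show ?thesis by (simp add: ereal_minus_le)
qed

lemma conj_cost_nonneg: "c 0 = 0 \<Longrightarrow> 0 \<le> conj_cost c u"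
  unfolding conj_cost_def by (rule SUP_upper2[of 0]) auto

text \<open>
  Here \<open>P f\<close> is lower semicontinuous and \<open>P f \<ge> f\<close> as \<open>c 0 = 0\<close>, so the integral of \<open>P f - f\<close>
  is meaningful and the sup-convolution form applies with \<open>l = \<eta> + K\<close>.
\<close>

lemma Ent_exp_le_conj_cost:
  fixes f c :: "'v::euclidean_space \<Rightarrow> real"
  assumes \<mu>: "borel_prob \<mu>" and T: "transport_entropy_ineq (\<lambda>x y. c (x - y)) C \<mu>"
    and c: "\<And>x. 0 \<le> c x" "\<And>x. c differentiable (at x)" and sym: "\<And>x. c (- x) = c x"
    and c0: "c 0 = 0" "grad c 0 = 0"
    and K: "0 \<le> K" and \<eta>: "0 < \<eta>" and KC: "(\<eta> + K) * C < 1"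
    and f: "\<And>x. f differentiable (at x)" and sc: "semi_concave K c f"
    and int: "integrable \<mu> (\<lambda>x. exp (f x))"
  shows "Ent \<mu> (\<lambda>x. exp (f x)) \<le> ereal (\<eta> / (1 - C * (\<eta> + K)))
           * ext_integral \<mu> (\<lambda>x. conj_cost c ((1 / \<eta>) *\<^sub>R grad f x))
           * ereal (\<integral>x. exp (f x) \<partial>\<mu>)"
proof -
  define l where "l = \<eta> + K"
  have cc: "continuous_on UNIV c" and fc: "continuous_on UNIV f"
    using c(2) f by (auto intro!: continuous_at_imp_continuous_on differentiable_imp_continuous_within)
  have cm: "continuous_on S (\<lambda>x. c (g x))" if "continuous_on S g" for S and g :: "'b::topological_space \<Rightarrow> 'v"
    using continuous_on_compose2[OF cc that] by auto
  let ?w = "\<lambda>x. sup_conv (\<lambda>x y. c (x - y)) l f x - ereal (f x)"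
  let ?v = "\<lambda>x. conj_cost c ((1 / \<eta>) *\<^sub>R grad f x)"
  have w0: "0 \<le> ?w x" for x
  proof -
    have "ereal (f x) \<le> sup_conv (\<lambda>x y. c (x - y)) l f x"
      unfolding sup_conv_def by (rule SUP_upper2[of x]) (simp_all add: c0)
    then show ?thesis by (simp add: ereal_diff_positive)
  qed
  have "sup_conv (\<lambda>x y. c (x - y)) l f \<in> borel_measurable borel"
    unfolding sup_conv_def[abs_def]
    by (rule borel_measurable_SUP_continuous)
       (auto intro!: continuous_intros cm)
  moreover have "f \<in> borel_measurable borel" using fc by (rule borel_measurable_continuous_onI)
  ultimately have "?w \<in> borel_measurable borel" by measurable
  then have "?w \<in> borel_measurable (completion \<mu>)"
    by (intro measurable_completion) (simp add: measurable_cong_sets[OF borel_probD(2)[OF \<mu>] refl])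
  then have ext: "has_ext_integral (completion \<mu>) ?w"
    using w0 by (simp add: has_ext_integral_def e2ennreal_neg)
  have "Ent \<mu> (\<lambda>x. exp (f x)) \<le> ereal (1 / (1 - l * C)) * ext_integral (completion \<mu>) ?w
           * ereal (\<integral>x. exp (f x) \<partial>\<mu>)"
  proof (rule Ent_exp_le_sup_conv[OF \<mu> T])
    show "(\<lambda>(x, y). c (x - y)) \<in> borel_measurable borel"
      by (intro borel_measurable_continuous_onI) (auto simp: case_prod_beta intro!: cm continuous_intros)
    show "c (x - y) = c (y - x)" for x y using sym[of "x - y"] by simp
  qed (use c K \<eta> KC int ext fc in \<open>auto simp: l_def intro: borel_measurable_continuous_onI\<close>)
  also have "\<dots> \<le> ereal (1 / (1 - l * C)) * (ereal \<eta> * ext_integral \<mu> ?v) * ereal (\<integral>x. exp (f x) \<partial>\<mu>)"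
  proof (intro ereal_mult_right_mono ereal_mult_left_mono)
    have wm: "(\<lambda>x. e2ennreal (?w x)) \<in> borel_measurable (completion \<mu>)"
      using ext unfolding has_ext_integral_def by (auto intro: measurable_compose[OF _ measurable_e2ennreal])
    \<comment> \<open>The constant is pulled out of the integral of the Borel function \<open>P f - f\<close>, and the
      conjugate then enters only through monotonicity of the integral.\<close>
    have inv: "ennreal \<eta> * (ennreal (1 / \<eta>) * z) = z" "ennreal (1 / \<eta>) * (ennreal \<eta> * z) = z" for z
      using \<eta> by (simp_all add: mult.assoc[symmetric] ennreal_mult[symmetric])
    have le: "ennreal (1 / \<eta>) * e2ennreal (?w x) \<le> e2ennreal (?v x)" for x
    proof -
      have "?w x \<le> ereal \<eta> * ?v x"
        unfolding l_def using f cc sym c(2) c0 sc \<eta> by (rule sup_conv_minus_le_conj_cost)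
      also have "\<dots> = enn2ereal (ennreal \<eta> * e2ennreal (?v x))"
        using \<eta> by (simp add: times_ennreal.rep_eq enn2ereal_e2ennreal conj_cost_nonneg c0)
      finally have "e2ennreal (?w x) \<le> ennreal \<eta> * e2ennreal (?v x)"
        by (metis e2ennreal_mono e2ennreal_enn2ereal)
      then have "ennreal (1 / \<eta>) * e2ennreal (?w x) \<le> ennreal (1 / \<eta>) * (ennreal \<eta> * e2ennreal (?v x))"
        by (rule mult_left_mono) simp
      then show ?thesis by (simp only: inv)
    qed
    have "(\<integral>\<^sup>+x. e2ennreal (?w x) \<partial>completion \<mu>) =
        ennreal \<eta> * (\<integral>\<^sup>+x. ennreal (1 / \<eta>) * e2ennreal (?w x) \<partial>completion \<mu>)"
      using wm by (subst nn_integral_cmult) (simp_all only: inv)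
    also have "\<dots> \<le> ennreal \<eta> * (\<integral>\<^sup>+x. e2ennreal (?v x) \<partial>completion \<mu>)"
      by (intro mult_left_mono nn_integral_mono le) simp
    finally have "enn2ereal (\<integral>\<^sup>+x. e2ennreal (?w x) \<partial>completion \<mu>)
        \<le> ereal \<eta> * enn2ereal (\<integral>\<^sup>+x. e2ennreal (?v x) \<partial>\<mu>)"
      using \<eta> by (simp add: less_eq_ennreal.rep_eq times_ennreal.rep_eq nn_integral_completion)
    then show "ext_integral (completion \<mu>) ?w \<le> ereal \<eta> * ext_integral \<mu> ?v"
      using w0 by (simp add: ext_integral_nonneg conj_cost_nonneg c0)
  qed (use KC in \<open>auto simp: l_def\<close>)
  also have "\<dots> = ereal (\<eta> / (1 - C * (\<eta> + K))) * ext_integral \<mu> ?v * ereal (\<integral>x. exp (f x) \<partial>\<mu>)"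
    by (simp add: l_def mult.assoc[symmetric] mult.commute)
  finally show ?thesis .
qed

theorem theorem6p7:
  "(\<forall>(c :: 'a::polish_space \<Rightarrow> 'a \<Rightarrow> real) \<mu> C.
      (\<lambda>(x, y). c x y) \<in> borel_measurable borel \<and>
      (\<forall>x y. 0 \<le> c x y) \<and> (\<forall>x y. c x y = c y x) \<and>
      borel_prob \<mu> \<and> 0 < C \<and> transport_entropy_ineq c C \<mu> \<longrightarrow>
      (\<forall>l f. 0 < l \<and> l < 1 / C \<and>
         f \<in> borel_measurable borel \<and>
         integrable \<mu> (\<lambda>x. exp (f x)) \<and>
         has_ext_integral (completion \<mu>) (\<lambda>x. sup_conv c l f x - ereal (f x)) \<longrightarrow>
         Ent \<mu> (\<lambda>x. exp (f x)) \<le>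
           ereal (1 / (1 - l * C))
           * ext_integral (completion \<mu>) (\<lambda>x. sup_conv c l f x - ereal (f x))
           * ereal (\<integral>x. exp (f x) \<partial>\<mu>)))
   \<and>
   (\<forall>(c :: real ^ 'k \<Rightarrow> real) \<mu> C.
      (\<forall>x. 0 \<le> c x) \<and> (\<forall>x. c differentiable (at x)) \<and>
      (\<forall>x. c (- x) = c x) \<and> c 0 = 0 \<and> grad c 0 = 0 \<and>
      borel_prob \<mu> \<and> 0 < C \<and> transport_entropy_ineq (\<lambda>x y. c (x - y)) C \<mu> \<longrightarrow>
      (\<forall>K \<eta> f. 0 \<le> K \<and> 0 < \<eta> \<and> \<eta> + K < 1 / C \<and>
         (\<forall>x. f differentiable (at x)) \<and> semi_concave K c f \<and>
         integrable \<mu> (\<lambda>x. exp (f x)) \<longrightarrow>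
         Ent \<mu> (\<lambda>x. exp (f x)) \<le>
           ereal (\<eta> / (1 - C * (\<eta> + K)))
           * ext_integral \<mu> (\<lambda>x. conj_cost c ((1 / \<eta>) *\<^sub>R grad f x))
           * ereal (\<integral>x. exp (f x) \<partial>\<mu>)))"
  (is "?A \<and> ?B")
proof
  have lC: "l * C < 1" if "0 < C" "l < 1 / C" for l C :: real
    using that by (simp add: pos_less_divide_eq)
  show ?A
    by (intro allI impI; elim conjE; rule Ent_exp_le_sup_conv;
        (assumption | (rule lC; assumption) | blast))
  show ?B
    by (intro allI impI; elim conjE; rule Ent_exp_le_conj_cost;
        (assumption | (rule lC; assumption) | blast))
qed

end
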